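(* Let $X$ be a Tychonoff space, let $E$ be a dense sublattice of $C(X)$, let $K,L\subset X$ be compact and disjoint, and let $f\in E$. Then there is $e\in E$ which coincides with $f$ on $K$ and vanishes on $L$.
   Context: $C(X)$ is the vector lattice of all continuous real-valued functions on $X$ with pointwise operations, endowed with the compact-open topology (density is with respect to this topology). A sublattice is a linear subspace closed under the pointwise lattice operations. *)

theory Defs
  imports "HOL-Analysis.Analysis"
begin

definition Tychonoff_space :: "'a topology \<Rightarrow> bool" where
  "Tychonoff_space X \<longleftrightarrow> completely_regular_space X \<and> Hausdorff_space X"

(* Functions on the carrier topspace X are represented extensionally (value undefined off the
   carrier), so that equality in C_of X is equality of functions on X; this is why the pointwise
   operations below are written with restricted abstraction. *)
definition C_of :: "'a topology \<Rightarrow> ('a \<Rightarrow> real) set" where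
  "C_of X = {f \<in> extensional (topspace X). continuous_map X euclideanreal f}"

definition compact_open_topology :: "'a topology \<Rightarrow> ('a \<Rightarrow> real) topology" where
  "compact_open_topology X =
     topology_generated_by {{f \<in> C_of X. f ` K \<subseteq> U} |K U. compactin X K \<and> open U}"

lemma topspace_compact_open_topology [simp]: "topspace (compact_open_topology X) = C_of X"
proof -
  have "{f \<in> C_of X. f ` {} \<subseteq> (UNIV::real set)}
          \<in> {{f \<in> C_of X. f ` K \<subseteq> U} |K U. compactin X K \<and> open U}"
    by (intro CollectI exI[of _ "{}"] exI[of _ UNIV]) auto
  then show ?thesis
    unfolding compact_open_topology_def topology_generated_by_topspace by auto
qed

definition sublattice_of_C :: "'a topology \<Rightarrow> ('a \<Rightarrow> real) set \<Rightarrow> bool" where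
  "sublattice_of_C X E \<longleftrightarrow>
     E \<subseteq> C_of X \<and>
     (\<lambda>x\<in>topspace X. 0) \<in> E \<and>
     (\<forall>f\<in>E. \<forall>g\<in>E. (\<lambda>x\<in>topspace X. f x + g x) \<in> E) \<and>
     (\<forall>c. \<forall>f\<in>E. (\<lambda>x\<in>topspace X. c * f x) \<in> E) \<and>
     (\<forall>f\<in>E. \<forall>g\<in>E. (\<lambda>x\<in>topspace X. max (f x) (g x)) \<in> E) \<and>
     (\<forall>f\<in>E. \<forall>g\<in>E. (\<lambda>x\<in>topspace X. min (f x) (g x)) \<in> E)"

definition dense_in_C :: "'a topology \<Rightarrow> ('a \<Rightarrow> real) set \<Rightarrow> bool" where
  "dense_in_C X E \<longleftrightarrow> compact_open_topology X closure_of E = C_of X"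

end

theory Submission
  imports Defs
begin

text \<open>A sublattice element can be truncated by another one: if \<open>g \<ge> 0\<close>, then
  \<open>max (min f g) (- g)\<close> equals \<open>f\<close> wherever \<open>\<bar>f\<bar> \<le> g\<close> and equals \<open>0\<close> wherever \<open>g = 0\<close>. So it
  suffices to find \<open>g \<in> E\<close> that dominates \<open>\<bar>f\<bar>\<close> on \<open>K\<close> and vanishes on \<open>L\<close>. A sublattice need
  not contain constants, and density gives only approximations, so a \<open>g\<close> with exact zeros on \<open>L\<close>
  is not available directly. But the open conditions \<open>g > m\<close> on \<open>K\<close> and \<open>g < 0\<close> on \<open>L\<close> define a
  neighbourhood in the compact-open topology, which is nonempty by Urysohn's lemma and hence meets
  \<open>E\<close> (\<open>dense_separates_compact\<close>); taking the positive part then turns the strict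
  negativity on \<open>L\<close> into vanishing.\<close>

lemma dense_in_C_meets_open:
  assumes "dense_in_C X E" "openin (compact_open_topology X) W" "h \<in> W"
  obtains g where "g \<in> E" "g \<in> W"
proof -
  have "h \<in> compact_open_topology X closure_of E"
    using assms openin_subset unfolding dense_in_C_def by fastforce
  with assms that show ?thesis
    unfolding in_closure_of by blast
qed

lemma openin_compact_open_subbasic:
  assumes "compactin X K" "open U"
  shows "openin (compact_open_topology X) {f \<in> C_of X. f ` K \<subseteq> U}"
  unfolding compact_open_topology_def
  by (rule topology_generated_by_Basis) (use assms in blast)

text \<open>Strict inequalities on compact sets are open conditions in the compact-open topology, so
  they pass from a Urysohn function to a nearby element of \<open>E\<close>. The value \<open>-1\<close> prescribed on \<open>L\<close>
  leaves room for the approximation error, which the value \<open>0\<close> would not.\<close>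

lemma dense_separates_compact:
  fixes m :: real
  assumes X: "Tychonoff_space X" and dense: "dense_in_C X E"
    and K: "compactin X K" and L: "compactin X L" and disj: "K \<inter> L = {}"
  obtains g where "g \<in> E" "\<And>x. x \<in> K \<Longrightarrow> m < g x" "\<And>x. x \<in> L \<Longrightarrow> g x < 0"
proof -
  have "closedin X K"
    using X K compactin_imp_closedin unfolding Tychonoff_space_def by blast
  moreover have "completely_regular_space X" "disjnt K L" "- 1 \<le> \<bar>m\<bar> + 1"
    using X disj by (auto simp: Tychonoff_space_def disjnt_def)
  \<comment> \<open>\<open>\<bar>m\<bar> + 1\<close> exceeds \<open>m\<close> and also \<open>- 1\<close>, so the target interval is nonempty for every \<open>m\<close>.\<close>
  ultimately obtain h where
    h: "continuous_map X (top_of_set {- 1..\<bar>m\<bar> + 1}) h" "h ` L \<subseteq> {- 1}" "h ` K \<subseteq> {\<bar>m\<bar> + 1}"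
    using Urysohn_completely_regular_closed_compact L by metis
  let ?W = "{f \<in> C_of X. f ` K \<subseteq> {m<..}} \<inter> {f \<in> C_of X. f ` L \<subseteq> {..<0}}"
  have sub: "K \<subseteq> topspace X" "L \<subseteq> topspace X"
    using K L compactin_subset_topspace by auto
  have "continuous_map X euclideanreal h"
    using h(1) by (rule continuous_map_into_fulltopology)
  then have "continuous_map X euclideanreal (restrict h (topspace X))"
    by (rule continuous_map_eq) simp
  then have "restrict h (topspace X) \<in> C_of X"
    by (simp add: C_of_def)
  moreover have "restrict h (topspace X) ` K = h ` K" "restrict h (topspace X) ` L = h ` L"
    using sub by (auto intro!: image_cong)
  ultimately have "restrict h (topspace X) \<in> ?W"
    using h(2,3) by auto
  moreover have "openin (compact_open_topology X) ?W"
    by (intro openin_Int openin_compact_open_subbasic K L) auto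
  ultimately obtain g where "g \<in> E" "g \<in> ?W"
    using dense_in_C_meets_open[OF dense] by blast
  then show thesis
    by (intro that) auto
qed

text \<open>Truncating \<open>f\<close> at the heights \<open>\<plusminus> max g 0\<close> turns it into a function that is unchanged where
  \<open>g \<ge> \<bar>f\<bar>\<close> and vanishes where \<open>g \<le> 0\<close>.\<close>

lemma sublattice_truncation:
  assumes E: "sublattice_of_C X E" and f: "f \<in> E" and g: "g \<in> E"
  shows "(\<lambda>x\<in>topspace X. max (min (f x) (max (g x) 0)) (- max (g x) 0)) \<in> E"
proof -
  define p where "p = (\<lambda>x\<in>topspace X. max (g x) ((\<lambda>x\<in>topspace X. 0) x))"
  define q where "q = (\<lambda>x\<in>topspace X. (- 1) * p x)"
  define r where "r = (\<lambda>x\<in>topspace X. min (f x) (p x))"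
  have "p \<in> E"
    using E g unfolding sublattice_of_C_def p_def by blast
  then have "q \<in> E" "r \<in> E"
    using E f unfolding sublattice_of_C_def q_def r_def by blast+
  then have "(\<lambda>x\<in>topspace X. max (r x) (q x)) \<in> E"
    using E unfolding sublattice_of_C_def by blast
  also have "(\<lambda>x\<in>topspace X. max (r x) (q x)) =
      (\<lambda>x\<in>topspace X. max (min (f x) (max (g x) 0)) (- max (g x) 0))"
    by (auto simp: p_def q_def r_def)
  finally show ?thesis .
qed

theorem corollary2p2:
  fixes X :: "'a topology" and E :: "('a \<Rightarrow> real) set" and K L :: "'a set" and f :: "'a \<Rightarrow> real"
  assumes "Tychonoff_space X"
    and "sublattice_of_C X E"
    and "dense_in_C X E"
    and "compactin X K" and "compactin X L" and "K \<inter> L = {}"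
    and "f \<in> E"
  shows "\<exists>e\<in>E. (\<forall>x\<in>K. e x = f x) \<and> (\<forall>x\<in>L. e x = 0)"
proof -
  have "continuous_map X euclideanreal f"
    using assms(2,7) by (auto simp: sublattice_of_C_def C_of_def)
  then have "compact (f ` K)"
    using image_compactin[OF assms(4)] by fastforce
  then obtain m where m: "\<bar>f x\<bar> \<le> m" if "x \<in> K" for x
    using compact_imp_bounded bounded_iff by (metis imageI real_norm_def)
  obtain g where g: "g \<in> E" "\<And>x. x \<in> K \<Longrightarrow> m < g x" "\<And>x. x \<in> L \<Longrightarrow> g x < 0"
    using dense_separates_compact[OF assms(1,3,4,5,6)] by metis
  let ?e = "\<lambda>x\<in>topspace X. max (min (f x) (max (g x) 0)) (- max (g x) 0)"
  have sub: "K \<subseteq> topspace X" "L \<subseteq> topspace X"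
    using assms(4,5) compactin_subset_topspace by auto
  have "?e x = f x" if "x \<in> K" for x
    using m[OF that] g(2)[OF that] sub(1) that by auto
  moreover have "?e x = 0" if "x \<in> L" for x
    using g(3)[OF that] sub(2) that by auto
  ultimately show ?thesis
    using sublattice_truncation[OF assms(2,7) g(1)] by blast
qed

end
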